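(* Let $p$ be a prime, $n$ and $i$ positive integers, and assume $p^n\equiv 1\pmod 9$. Let $s=\frac{p^n-1}{3}$ and let $\zeta$ be an element of $\mathbb{F}_{p^n}$ of (multiplicative) order $3$. Then $$f(x)=x(x^s-\zeta)(x^s-\zeta^2)+x^{p^i}(x^s-1)(x^s-\zeta^2)+\zeta x^p(x^s-1)(x^s-\zeta)$$ is a permutation polynomial over $\mathbb{F}_{p^n}$ if and only if (i) $p\equiv 1\pmod 3$; or (ii) $i$ is odd and $p\equiv 2\pmod 3$.
   Context: A polynomial is a permutation polynomial (PP) over a finite field if it induces a bijection of that field to itself. *)

theory Defs
  imports "HOL-Computational_Algebra.Computational_Algebra" "HOL-Number_Theory.Cong"
    "HOL-Library.Cardinality"
begin

definition permutation_poly :: "'a::finite_field poly \<Rightarrow> bool" where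
  "permutation_poly f \<longleftrightarrow> bij (poly f)"

text \<open>
  The order is 0 for elements without a positive power equal to 1; in a finite field this
  is only the zero element.
\<close>
definition mult_order :: "'a::monoid_mult \<Rightarrow> nat" where
  "mult_order x =
     (if \<exists>d>0. x ^ d = 1 then LEAST d. d > 0 \<and> x ^ d = 1 else 0)"

abbreviation poly_X :: "'a::comm_semiring_1 poly" where
  "poly_X \<equiv> monom 1 1"

end

theory Submission
  imports Defs
begin

text \<open>
  The map \<open>x \<mapsto> x ^ s\<close> partitions the nonzero elements into the three classes over
  \<open>1\<close>, \<open>\<zeta>\<close>, \<open>\<zeta>\<^sup>2\<close>, and on them \<open>f\<close> is \<open>3 * x\<close>,
  \<open>3 * \<zeta>\<^sup>2 * x ^ (p ^ i)\<close> and \<open>3 * \<zeta>\<^sup>2 * x ^ p\<close>, respectively.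
  Powers of \<open>p\<close> are injective exponents and \<open>\<zeta> ^ s = 1\<close> because \<open>9\<close> divides
  \<open>p ^ n - 1\<close>. Hence, up to the factor \<open>3 ^ s\<close>, the polynomial \<open>f\<close> sends the three
  classes to the classes over \<open>1\<close>, \<open>\<zeta> ^ (p ^ i)\<close>, \<open>\<zeta> ^ (2 * p)\<close>, and it is a
  permutation iff these are distinct.
\<close>

lemma mult_order_eq_3D:
  assumes "mult_order x = 3"
  shows "x ^ 3 = 1" "x \<noteq> 1"
proof -
  have ex: "\<exists>d>0. x ^ d = 1" and L: "(LEAST d. d > 0 \<and> x ^ d = 1) = 3"
    using assms by (auto simp: mult_order_def split: if_splits)
  show "x ^ 3 = 1"
    using LeastI_ex[OF ex] L by simp
  show "x \<noteq> 1"
  proof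
    assume "x = 1"
    hence "(LEAST d. d > 0 \<and> x ^ d = 1) \<le> 1" by (intro Least_le) auto
    thus False using L by simp
  qed
qed

text \<open>The solutions are the roots of \<open>X ^ n - c\<close>. With \<open>n = s\<close> this
  bounds the size of a class in the counting argument for the converse.\<close>

lemma card_nth_roots_le:
  fixes c :: "'a::idom"
  assumes "n > 0"
  shows "card {x. x ^ n = c} \<le> n"
proof -
  have "degree (monom 1 n + [:-c:]) = n"
    using assms by (simp add: degree_add_eq_left degree_monom_eq)
  moreover from this have "monom 1 n + [:-c:] \<noteq> 0" using assms by auto
  ultimately show ?thesis
    using card_poly_roots_bound[of "monom 1 n + [:-c:]"] by (simp add: poly_monom)
qed

lemma finite_field_power_card_minus_1:
  fixes x :: "'a::finite_field"
  assumes "x \<noteq> 0"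
  shows "x ^ (CARD('a) - 1) = 1"
proof -
  have "x * x ^ (CARD('a) - 1) = x"
    using finite_field_power_card_eq_same[of x] by (simp flip: power_Suc)
  thus ?thesis using assms by simp
qed

text \<open>The \<open>n\<close>-fold iterate of the \<open>p ^ i\<close>-th power map is the
  \<open>i\<close>-fold iterate of the \<open>p ^ n\<close>-th power map, which is the identity; so
  the map has a left inverse.\<close>

lemma finite_field_power_card_root_inj:
  fixes x y :: "'a::finite_field"
  assumes "CARD('a) = p ^ n" "n > 0" "x ^ (p ^ i) = y ^ (p ^ i)"
  shows "x = y"
proof -
  have "z ^ (p ^ i) ^ n = z" for z :: 'a
    using finite_field_power_card_power_eq_same[of "(p ^ i) ^ n" i z] assms(1)
    by (simp add: mult.commute flip: power_mult)
  thus ?thesis using assms(2,3) by (metis power_mult gr0_implies_Suc power_Suc)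
qed

lemma power_mod_order:
  fixes x :: "'a::monoid_mult"
  assumes "x ^ m = 1"
  shows "x ^ k = x ^ (k mod m)"
proof -
  have "x ^ k = x ^ (m * (k div m) + k mod m)" by simp
  also have "\<dots> = x ^ (k mod m)" unfolding power_add power_mult by (simp add: assms)
  finally show ?thesis .
qed

theorem theorem2p22:
  fixes p n i s :: nat and \<zeta> :: "'a::finite_field" and f :: "'a poly"
  assumes "prime p" and "n > 0" and "i > 0"
    and "[p ^ n = 1] (mod 9)"
    and "CARD('a) = p ^ n"
    and "s = (p ^ n - 1) div 3"
    and "mult_order \<zeta> = 3"
    and "f = poly_X * (poly_X ^ s - [:\<zeta>:]) * (poly_X ^ s - [:\<zeta>\<^sup>2:])
           + poly_X ^ (p ^ i) * (poly_X ^ s - 1) * (poly_X ^ s - [:\<zeta>\<^sup>2:])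
           + [:\<zeta>:] * poly_X ^ p * (poly_X ^ s - 1) * (poly_X ^ s - [:\<zeta>:])"
  shows "permutation_poly f \<longleftrightarrow>
           [p = 1] (mod 3) \<or> (odd i \<and> [p = 2] (mod 3))"
proof -
  note z3 = mult_order_eq_3D(1)[OF assms(7)] and z1 = mult_order_eq_3D(2)[OF assms(7)]
  have z0: "\<zeta> \<noteq> 0" using z3 by auto
  have "(\<zeta> - 1) * (\<zeta>\<^sup>2 + \<zeta> + 1) = 0"
    using z3 by (simp add: algebra_simps power2_eq_square power3_eq_cube)
  hence zz: "\<zeta>\<^sup>2 = - \<zeta> - 1" using z1 by (simp add: eq_neg_iff_add_eq_0 eq_diff_eq add_ac)
  have z2: "\<zeta>\<^sup>2 \<noteq> 1" "\<zeta>\<^sup>2 \<noteq> \<zeta>"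
    using z3 z1 z0 by (auto simp: power2_eq_square power3_eq_cube)
  \<comment> \<open>This evaluates \<open>X ^ 2 + X + 1\<close> at \<open>1\<close>. Both factors
    are nonzero, so the characteristic is not 3 and \<open>3 ^ s\<close> can be cancelled
    later.\<close>
  have three: "(1 - \<zeta>) * (1 - \<zeta>\<^sup>2) = 3" using zz by algebra
  hence three0: "(3 :: 'a) \<noteq> 0" using z1 z2 by auto
  have "p ^ n \<ge> 2" using assms(1,2) prime_ge_2_nat[of p] 
    by (metis One_nat_def Suc_leI le_trans self_le_power prime_gt_0_nat)
  have "9 dvd p ^ n - 1"
    using assms(4) \<open>p ^ n \<ge> 2\<close> by (simp add: cong_altdef_nat)
  then obtain t where "p ^ n - 1 = 9 * t" by (elim dvdE)
  hence t: "s = 3 * t" "p ^ n = Suc (3 * s)" "s > 0"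
    using assms(6) \<open>p ^ n \<ge> 2\<close> by simp_all
  have zs: "\<zeta> ^ s = 1" by (simp add: t(1) power_mult z3)
  have "\<not> 3 dvd p"
  proof
    assume "3 dvd p"
    hence "3 dvd p ^ n" using assms(2) by (simp add: dvd_power_iff_le dvd_trans dvd_power)
    thus False using t(2) by presburger
  qed
  hence pmod: "p mod 3 = 1 \<or> p mod 3 = 2" by presburger
  have cls: "x ^ s = 1 \<or> x ^ s = \<zeta> \<or> x ^ s = \<zeta>\<^sup>2" if "x \<noteq> 0" for x :: 'a
  proof -
    have "(x ^ s) ^ 3 = 1"
      using finite_field_power_card_minus_1[OF that] assms(5) t(2)
      by (simp add: mult.commute flip: power_mult)
    moreover have "(w - 1) * (w - \<zeta>) * (w - \<zeta>\<^sup>2) = w ^ 3 - 1" for w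
      using zz by algebra
    ultimately have "(x ^ s - 1) * (x ^ s - \<zeta>) * (x ^ s - \<zeta>\<^sup>2) = 0" by simp
    thus ?thesis by auto
  qed
  have f: "poly f x = x * (x ^ s - \<zeta>) * (x ^ s - \<zeta>\<^sup>2) + x ^ (p ^ i) * (x ^ s - 1) * (x ^ s - \<zeta>\<^sup>2)
             + \<zeta> * x ^ p * (x ^ s - 1) * (x ^ s - \<zeta>)" for x
    by (simp add: assms(8) poly_monom)
  have f0: "poly f 0 = 0"
    using prime_gt_0_nat[OF assms(1)] by (simp add: f zero_power)
  \<comment> \<open>On each class two summands of \<open>f\<close> vanish. The remaining pair of
    factors is the derivative \<open>3 * w ^ 2\<close> of \<open>w ^ 3 - 1\<close> at the root
    \<open>w = x ^ s\<close>; at \<open>\<zeta>\<^sup>2\<close> it is \<open>3 * \<zeta>\<close>,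
    and the extra coefficient \<open>\<zeta>\<close> turns this into
    \<open>3 * \<zeta>\<^sup>2\<close>.\<close>
  have e1: "u * (1 - \<zeta>) * (1 - \<zeta>\<^sup>2) = 3 * u" for u using zz by algebra
  have e2: "u * (\<zeta> - 1) * (\<zeta> - \<zeta>\<^sup>2) = 3 * \<zeta>\<^sup>2 * u" for u using zz by algebra
  have e3: "\<zeta> * u * (\<zeta>\<^sup>2 - 1) * (\<zeta>\<^sup>2 - \<zeta>) = 3 * \<zeta>\<^sup>2 * u" for u using zz by algebra
  have f1: "poly f x = 3 * x" if "x ^ s = 1" for x
    unfolding f that by (simp add: e1)
  have f2: "poly f x = 3 * \<zeta>\<^sup>2 * x ^ (p ^ i)" if "x ^ s = \<zeta>" for x
    unfolding f that by (simp add: e2)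
  have f3: "poly f x = 3 * \<zeta>\<^sup>2 * x ^ p" if "x ^ s = \<zeta>\<^sup>2" for x
    unfolding f that by (simp add: e3)
  have zs2: "(\<zeta>\<^sup>2) ^ s = 1" using zs by (metis power_mult mult.commute power_one)
  have swap: "(x ^ k) ^ s = (x ^ s) ^ k" for x :: 'a and k
    by (simp add: mult.commute flip: power_mult)
  have g1: "poly f x ^ s = 3 ^ s" if "x ^ s = 1" for x
    unfolding f1[OF that] by (simp add: power_mult_distrib that)
  have g2: "poly f x ^ s = 3 ^ s * \<zeta> ^ (p ^ i mod 3)" if "x ^ s = \<zeta>" for x
    by (simp only: f2[OF that] power_mult_distrib zs2 swap[of x] that mult_1_right
          flip: power_mod_order[OF z3, of "p ^ i"])
  have g3: "poly f x ^ s = 3 ^ s * \<zeta> ^ (2 * p mod 3)" if "x ^ s = \<zeta>\<^sup>2" for x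
    by (simp only: f3[OF that] power_mult_distrib zs2 swap[of x] that mult_1_right power_mult
          flip: power_mod_order[OF z3, of "2 * p"])
  have pi: "p ^ i mod 3 = (if p mod 3 = 1 \<or> even i then 1 else 2)"
  proof (cases "p mod 3 = 1")
    case True
    thus ?thesis using power_mod[of p 3 i] by simp
  next
    case False
    hence p2: "p mod 3 = 2" using pmod by simp
    have "2 ^ i mod 3 = (if even i then 1 else 2 :: nat)"
    proof (induction i)
      case (Suc i)
      have "2 ^ Suc i mod 3 = 2 * (2 ^ i mod 3) mod (3 :: nat)" by (simp add: mod_mult_right_eq)
      thus ?case unfolding Suc by simp
    qed simp
    thus ?thesis using p2 power_mod[of p 3 i] by simp
  qed
  have p2: "2 * p mod 3 = (if p mod 3 = 1 then 2 else 1)" using pmod by presburger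
  show ?thesis
  proof
    assume R: "[p = 1] (mod 3) \<or> (odd i \<and> [p = 2] (mod 3))"
    \<comment> \<open>The two exponents are 1 and 2 in some order, so the three classes stay
      distinct.\<close>
    have e: "p ^ i mod 3 = 1 \<and> 2 * p mod 3 = 2 \<or> p ^ i mod 3 = 2 \<and> 2 * p mod 3 = 1"
      using R pi p2 by (auto simp: cong_def)
    have h0: "poly f x \<noteq> 0" if "x \<noteq> 0" for x
      using cls[OF that] f1[of x] f2[of x] f3[of x] that z0 three0
      by (metis mult_eq_0_iff power_eq_0_iff)
    have "inj (poly f)"
    proof (rule injI)
      fix x y assume xy: "poly f x = poly f y"
      show "x = y"
      proof (cases "x = 0 \<or> y = 0")
        case True
        thus ?thesis using h0 f0 xy by metis
      next
        case False
        hence x: "x \<noteq> 0" and y: "y \<noteq> 0" by auto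
        \<comment> \<open>The induced action on classes, up to the factor \<open>3 ^ s\<close>; the
          last branch is meant for \<open>\<zeta>\<^sup>2\<close>. Its injectivity forces
          \<open>x\<close> and \<open>y\<close> into one class.\<close>
        define \<sigma> where "\<sigma> w = (if w = 1 then 1 else if w = \<zeta> then \<zeta> ^ (p ^ i mod 3)
          else \<zeta> ^ (2 * p mod 3))" for w
        have \<sigma>: "poly f u ^ s = 3 ^ s * \<sigma> (u ^ s)" if "u \<noteq> 0" for u
          using cls[OF that] z1 z2 by (elim disjE) (simp_all only: g1 g2 g3 \<sigma>_def if_True if_False refl mult_1_right)
        have "\<sigma> (x ^ s) = \<sigma> (y ^ s)"
          using \<sigma>[OF x] \<sigma>[OF y] xy three0 by simp
        moreover have "x ^ s \<in> {1, \<zeta>, \<zeta>\<^sup>2}" "y ^ s \<in> {1, \<zeta>, \<zeta>\<^sup>2}"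
          using cls x y by simp_all
        moreover have "inj_on \<sigma> {1, \<zeta>, \<zeta>\<^sup>2}"
          using e z1 z2 by (auto simp: inj_on_def \<sigma>_def)
        ultimately have xys: "y ^ s = x ^ s"
          by (metis inj_onD)
        have c0: "3 * \<zeta>\<^sup>2 \<noteq> 0" using z0 three0 by simp
        note inj = finite_field_power_card_root_inj[OF assms(5,2)]
        \<comment> \<open>Inside one class \<open>f\<close> is a nonzero constant times a power with
          exponent \<open>1\<close>, \<open>p ^ i\<close> or \<open>p = p ^ 1\<close>, hence
          injective.\<close>
        from cls[OF x] show ?thesis
        proof (elim disjE)
          assume 1: "x ^ s = 1"
          show ?thesis using xy[unfolded f1[OF 1] f1[OF xys[unfolded 1]]] three0 by simp
        next
          assume 1: "x ^ s = \<zeta>"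
          show ?thesis using xy[unfolded f2[OF 1] f2[OF xys[unfolded 1]]] c0
            by (intro inj[of x i y]) simp
        next
          assume 1: "x ^ s = \<zeta>\<^sup>2"
          show ?thesis using xy[unfolded f3[OF 1] f3[OF xys[unfolded 1]]] c0
            by (intro inj[of x 1 y]) simp
        qed
      qed
    qed
    thus "permutation_poly f"
      unfolding permutation_poly_def bij_def by (simp add: finite_UNIV_inj_surj)
  next
    assume L: "permutation_poly f"
    show "[p = 1] (mod 3) \<or> (odd i \<and> [p = 2] (mod 3))"
    proof (rule ccontr)
      assume "\<not> ?thesis"
      \<comment> \<open>Here \<open>p mod 3 = 2\<close> and \<open>i\<close> is even, so the classes
        over \<open>\<zeta>\<close> and \<open>\<zeta>\<^sup>2\<close> are sent to the same
        class.\<close>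
      hence e: "p ^ i mod 3 = 1" "2 * p mod 3 = 1"
        using pmod pi p2 by (auto simp: cong_def)
      \<comment> \<open>The image lies in 0 and two classes of at most \<open>s\<close> elements
        each, but \<open>2 * s + 1 < 3 * s + 1 = p ^ n\<close>.\<close>
      let ?A = "{y. y ^ s = (3 :: 'a) ^ s}" and ?B = "{y. y ^ s = 3 ^ s * \<zeta>}"
      have "poly f x \<in> insert 0 (?A \<union> ?B)" for x
      proof (cases "x = 0")
        case False
        have "poly f x ^ s = 3 ^ s \<or> poly f x ^ s = 3 ^ s * \<zeta>"
          using cls[OF False] by (elim disjE) (simp_all only: g1 g2 g3 e power_one_right simp_thms)
        thus ?thesis by blast
      qed (simp add: f0)
      hence "range (poly f) \<subseteq> insert 0 (?A \<union> ?B)" by blast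
      hence "UNIV \<subseteq> insert 0 (?A \<union> ?B)"
        using L unfolding permutation_poly_def bij_def by simp
      hence "CARD('a) \<le> card (insert 0 (?A \<union> ?B))" by (intro card_mono) auto
      also have "\<dots> \<le> Suc (card (?A \<union> ?B))" by (simp add: card_insert_if)
      also have "\<dots> \<le> Suc (card ?A + card ?B)" using card_Un_le by simp
      also have "\<dots> \<le> Suc (s + s)"
        using card_nth_roots_le[OF t(3)] by (intro add_mono Suc_le_mono[THEN iffD2])
      finally show False using assms(5) t(2,3) by simp
    qed
  qed
qed

end
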